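(* For $q>2$ (where $q$ is a prime power), the degree sequence of the solvable graph $\Gamma_{\mathfrak{S}}(\mathfrak{sl}_2(\mathbb{F}_q))$ consists of the value $2q^2-q-2$ occurring $\frac{q(q^2-1)}{2}$ times, the value $q^2-2$ occurring $q^2-1$ times, and the value $q-2$ occurring $\frac{q(q-1)^2}{2}$ times. Moreover, the graph $\Gamma_{\mathfrak{S}}(\mathfrak{sl}_2(\mathbb{F}_q))$ is non-connected for $q>2$.
   Context: $\mathbb{F}_q$ is the field with $q$ elements, and $\mathfrak{sl}_2(\mathbb{F}_q)$ is the Lie algebra of traceless $2\times 2$ matrices over $\mathbb{F}_q$ with bracket $[x,y]=xy-yx$. For elements $x,y$ of a Lie algebra $L$, $\langle x,y\rangle$ denotes the Lie subalgebra generated by $x$ and $y$. The solvabilizer of $L$ is $\mathrm{sol}(L)=\{x\in L \mid \langle h,x\rangle \text{ is solvable for all } h\in L\}$. For a finite-dimensional non-solvable Lie algebra $L$, the solvable graph $\Gamma_{\mathfrak{S}}(L)$ is the simple undirected graph with vertex set $L\setminus \mathrm{sol}(L)$ in which two distinct vertices $x,y$ are adjacent if and only if $\langle x,y\rangle$ is a solvable subalgebra of $L$; the same notation is also used for solvable $L$, where the graph is empty. The degree sequence is the list of vertex degrees with multiplicity.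
   Formalization: The degree sequence is stated only when sl_2(F_q) is non-solvable, i.e. for odd q: for q=4,8,... sl_2(F_q) is nilpotent, so the graph is empty and the printed degree sequence is false. Non-connectedness is kept for all q>2, counting the empty graph as non-connected. *)

theory Defs
  imports
    "HOL-Analysis.Determinants"
    "HOL-Library.Multiset"
    "Graph_Theory.Graph_Theory"
begin

locale lie_algebra = vector_space scale
  for scale :: "'k::field \<Rightarrow> 'v::ab_group_add \<Rightarrow> 'v" +
  fixes bracket :: "'v \<Rightarrow> 'v \<Rightarrow> 'v"
    and L :: "'v set"
  assumes subspace_carrier: "subspace L"
    and bracket_closed: "\<lbrakk>x \<in> L; y \<in> L\<rbrakk> \<Longrightarrow> bracket x y \<in> L"
    and bracket_add_left:
      "\<lbrakk>x \<in> L; y \<in> L; z \<in> L\<rbrakk> \<Longrightarrow> bracket (x + y) z = bracket x z + bracket y z"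
    and bracket_add_right:
      "\<lbrakk>x \<in> L; y \<in> L; z \<in> L\<rbrakk> \<Longrightarrow> bracket x (y + z) = bracket x y + bracket x z"
    and bracket_scale_left:
      "\<lbrakk>x \<in> L; y \<in> L\<rbrakk> \<Longrightarrow> bracket (scale c x) y = scale c (bracket x y)"
    and bracket_scale_right:
      "\<lbrakk>x \<in> L; y \<in> L\<rbrakk> \<Longrightarrow> bracket x (scale c y) = scale c (bracket x y)"
    and bracket_self: "x \<in> L \<Longrightarrow> bracket x x = 0"
    and jacobi: "\<lbrakk>x \<in> L; y \<in> L; z \<in> L\<rbrakk> \<Longrightarrow>
      bracket x (bracket y z) + bracket y (bracket z x) + bracket z (bracket x y) = 0"
begin

definition lie_subalgebra :: "'v set \<Rightarrow> bool" where
  "lie_subalgebra S \<longleftrightarrow>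
     subspace S \<and> S \<subseteq> L \<and> (\<forall>x\<in>S. \<forall>y\<in>S. bracket x y \<in> S)"

definition generated :: "'v set \<Rightarrow> 'v set" where
  "generated X = lie_subalgebra hull X"

definition derived_algebra :: "'v set \<Rightarrow> 'v set" where
  "derived_algebra S = span {bracket x y | x y. x \<in> S \<and> y \<in> S}"

definition solvable :: "'v set \<Rightarrow> bool" where
  "solvable S \<longleftrightarrow> (\<exists>n. (derived_algebra ^^ n) S = {0})"

definition solvabilizer :: "'v set" where
  "solvabilizer = {x \<in> L. \<forall>h\<in>L. solvable (generated {h, x})}"

text \<open>A simple undirected graph is represented as a loop-free symmetric digraph without parallel
  arcs, each edge contributing its two orientations. The degree of a vertex is then its out-degree.
  The definition makes sense for every \<open>L\<close>; for solvable \<open>L\<close> the graph has no vertices.\<close>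

definition solvable_graph :: "'v pair_pre_digraph" where
  "solvable_graph =
     \<lparr>pverts = L - solvabilizer,
      parcs = {(x, y). x \<in> L - solvabilizer \<and> y \<in> L - solvabilizer \<and> x \<noteq> y \<and>
                       solvable (generated {x, y})}\<rparr>"

lemma pair_bidirected_digraph_solvable_graph: "pair_bidirected_digraph solvable_graph"
  by unfold_locales
    (auto simp: solvable_graph_def symmetric_def insert_commute intro!: symI)

lemma pair_graph_solvable_graph:
  assumes "finite L"
  shows "pair_graph solvable_graph"
proof -
  interpret pair_bidirected_digraph solvable_graph
    by (rule pair_bidirected_digraph_solvable_graph)
  show ?thesis
  proof unfold_locales
    show "finite (pverts solvable_graph)"
      using assms by (simp add: solvable_graph_def)
    have "parcs solvable_graph \<subseteq> L \<times> L"
      by (auto simp: solvable_graph_def)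
    then show "finite (parcs solvable_graph)"
      using assms by (metis finite_SigmaI finite_subset)
  qed
qed

end

definition degree_sequence :: "'v pair_pre_digraph \<Rightarrow> nat multiset" where
  "degree_sequence G = image_mset (out_degree (with_proj G)) (mset_set (pverts G))"

definition mat_scale :: "'a::field \<Rightarrow> 'a^'n^'n \<Rightarrow> 'a^'n^'n" where
  "mat_scale c = map_matrix ((*) c)"

definition mat_commutator :: "'a::field^'n^'n \<Rightarrow> 'a^'n^'n \<Rightarrow> 'a^'n^'n" where
  "mat_commutator A B = A ** B - B ** A"

definition sl2 :: "('a::field^2^2) set" where
  "sl2 = {A. trace A = 0}"

lemma mat2_eq_iff:
  "(A :: 'a^2^2) = B \<longleftrightarrow>
     A$1$1 = B$1$1 \<and> A$1$2 = B$1$2 \<and> A$2$1 = B$2$1 \<and> A$2$2 = B$2$2"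
  by (auto simp: vec_eq_iff forall_2)

lemmas mat2_simps = mat2_eq_iff mat_scale_def mat_commutator_def matrix_matrix_mult_def sum_2

global_interpretation sl2: lie_algebra mat_scale mat_commutator "sl2 :: ('a::field^2^2) set"
proof -
  interpret vector_space "mat_scale :: 'a \<Rightarrow> 'a^2^2 \<Rightarrow> 'a^2^2"
    by unfold_locales (auto simp: mat2_simps algebra_simps)
  show "lie_algebra mat_scale mat_commutator (sl2 :: ('a^2^2) set)"
  proof
    show "subspace (sl2 :: ('a^2^2) set)"
      by (auto simp: subspace_def sl2_def trace_add)
        (auto simp: trace_def sum_2 mat_scale_def simp flip: distrib_left)
  next
    fix x y z :: "'a^2^2" and c :: 'a
    show "mat_commutator x y \<in> sl2"
      by (simp add: sl2_def mat_commutator_def trace_sub trace_mul_sym[of x y])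
    show "mat_commutator (x + y) z = mat_commutator x z + mat_commutator y z"
      by (simp add: mat2_simps algebra_simps)
    show "mat_commutator x (y + z) = mat_commutator x y + mat_commutator x z"
      by (simp add: mat2_simps algebra_simps)
    show "mat_commutator (mat_scale c x) y = mat_scale c (mat_commutator x y)"
      by (simp add: mat2_simps algebra_simps)
    show "mat_commutator x (mat_scale c y) = mat_scale c (mat_commutator x y)"
      by (simp add: mat2_simps algebra_simps)
    show "mat_commutator x x = 0"
      by (simp add: mat_commutator_def)
    show "mat_commutator x (mat_commutator y z) + mat_commutator y (mat_commutator z x) +
      mat_commutator z (mat_commutator x y) = 0"
      by (simp add: mat2_simps algebra_simps)
  qed
qed

text \<open>In characteristic 2 the identity matrix is traceless and \<open>sl2\<close> is nilpotent, so its
  solvable graph has no vertices at all; in every other characteristic \<open>sl2\<close> is perfect.\<close>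

lemma solvable_sl2_iff: "sl2.solvable (sl2 :: ('a::field^2^2) set) \<longleftrightarrow> (2::'a) = 0"
proof
  assume two: "(2::'a) = 0"
  have minus: "- c = c" for c :: 'a
  proof -
    have "c + c = 2 * c"
      by (rule mult_2[symmetric])
    also have "\<dots> = 0"
      by (simp only: two mult_zero_left)
    finally show ?thesis
      by (rule minus_unique)
  qed
  have diag: "A$2$2 = A$1$1" if "A \<in> sl2" for A :: "'a^2^2"
  proof -
    have "A$1$1 + A$2$2 = 0"
      using that by (simp add: sl2_def trace_def sum_2)
    then have "- (A$1$1) = A$2$2"
      by (rule minus_unique)
    then show ?thesis
      by (simp only: minus)
  qed
  let ?Z = "{A :: 'a^2^2. A$1$2 = 0 \<and> A$2$1 = 0 \<and> A$2$2 = A$1$1}"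
  have "sl2.subspace ?Z"
    by (auto simp: sl2.subspace_def mat_scale_def)
  moreover have "mat_commutator x y \<in> ?Z" if "x \<in> sl2" "y \<in> sl2" for x y :: "'a^2^2"
  proof -
    have "x$2$1 * y$1$2 - y$2$1 * x$1$2 = x$1$2 * y$2$1 - y$1$2 * x$2$1"
      using minus[of "x$1$2 * y$2$1 - y$1$2 * x$2$1"] by (simp add: mult.commute)
    then show ?thesis
      using diag[OF that(1)] diag[OF that(2)] by (simp add: mat2_simps algebra_simps)
  qed
  ultimately have Z: "sl2.derived_algebra sl2 \<subseteq> ?Z"
    unfolding sl2.derived_algebra_def by (intro sl2.span_minimal) auto
  have "mat_commutator x y = 0" if "x \<in> ?Z" "y \<in> ?Z" for x y :: "'a^2^2"
    using that by (simp add: mat2_simps algebra_simps)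
  then have "{mat_commutator x y |x y. x \<in> sl2.derived_algebra sl2 \<and> y \<in> sl2.derived_algebra sl2}
      \<subseteq> {0 :: 'a^2^2}"
    using Z by blast
  then have "sl2.derived_algebra (sl2.derived_algebra sl2) \<subseteq> sl2.span {0 :: 'a^2^2}"
    unfolding sl2.derived_algebra_def[of "sl2.derived_algebra sl2"] by (rule sl2.span_mono)
  then have "sl2.derived_algebra (sl2.derived_algebra sl2) = {0 :: 'a^2^2}"
    using sl2.span_zero unfolding sl2.derived_algebra_def[of "sl2.derived_algebra sl2"] by auto
  then show "sl2.solvable (sl2 :: ('a^2^2) set)"
    unfolding sl2.solvable_def by (intro exI[of _ 2]) (simp add: numeral_2_eq_2)
next
  assume solv: "sl2.solvable (sl2 :: ('a^2^2) set)"
  show "(2::'a) = 0"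
  proof (rule ccontr)
    assume two: "(2::'a) \<noteq> 0"
    define M :: "'a \<Rightarrow> 'a \<Rightarrow> 'a \<Rightarrow> 'a^2^2" where
      "M a b c = vector [vector [a, b], vector [c, - a]]" for a b c
    have M: "M a b c \<in> sl2" for a b c
      by (simp add: M_def sl2_def trace_def sum_2)
    have "A \<in> sl2.derived_algebra sl2" if "A \<in> sl2" for A :: "'a^2^2"
    proof -
      have tr: "A$2$2 = - (A$1$1)"
        using that by (simp add: sl2_def trace_def sum_2 eq_neg_iff_add_eq_0 add.commute)
      have "A = mat_commutator (M 0 1 0) (M 0 0 (A$1$1)) +
          (mat_commutator (M (1/2) 0 0) (M 0 (A$1$2) 0) +
           mat_commutator (M (1/2) 0 0) (M 0 0 (- (A$2$1))))"
        using two tr by (simp add: mat2_simps M_def field_simps)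
      also have "\<dots> \<in> sl2.derived_algebra sl2"
        unfolding sl2.derived_algebra_def using M by (intro sl2.span_add sl2.span_base) blast+
      finally show ?thesis .
    qed
    moreover have "sl2.derived_algebra sl2 \<subseteq> (sl2 :: ('a^2^2) set)"
      unfolding sl2.derived_algebra_def
      by (intro sl2.span_minimal sl2.subspace_carrier) (auto intro: sl2.bracket_closed)
    ultimately have perfect: "sl2.derived_algebra sl2 = (sl2 :: ('a^2^2) set)"
      by blast
    have "(sl2.derived_algebra ^^ n) sl2 = (sl2 :: ('a^2^2) set)" for n
      by (induction n) (simp_all add: perfect)
    then have "M 0 1 0 = 0"
      using solv M[of 0 1 0] by (auto simp: sl2.solvable_def)
    then show False
      by (simp add: mat2_eq_iff M_def)
  qed
qed

end

theory Submission
  imports Defs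
begin

text \<open>
  In characteristic 2 the graph has no vertices. Otherwise let \<open>discr\<close> be minus the determinant.
  Two elements \<open>x, y\<close> of \<open>sl2\<close> generate a solvable subalgebra iff \<open>discr [x, y] = 0\<close>: this number
  is the determinant of the coordinate vectors of \<open>x, y, [x, y]\<close>, so if it is nonzero
  they span the perfect algebra \<open>sl2\<close>, and if it vanishes then \<open>[x, y]\<close> lies in the span of \<open>x, y\<close>.
  For fixed \<open>x \<noteq> 0\<close> the form \<open>y \<mapsto> discr [x, y]\<close> is, in suitable coordinates \<open>(s, r, u)\<close> of \<open>y\<close>
  and up to a nonzero factor, \<open>u\<^sup>2 - r\<^sup>2 discr x\<close>. Its zero set has \<open>q (2 q - 1)\<close>, \<open>q\<^sup>2\<close> or \<open>q\<close>
  elements according to whether \<open>discr x\<close> is a nonzero square, zero, or a nonsquare; in the last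
  case it is the line through \<open>x\<close>, so that nonsquare \<open>discr\<close> is preserved along edges.
\<close>

section \<open>Solvability and generated subalgebras in an arbitrary Lie algebra\<close>

context lie_algebra
begin

lemma derived_algebra_mono: "S \<subseteq> T \<Longrightarrow> derived_algebra S \<subseteq> derived_algebra T"
  unfolding derived_algebra_def by (intro span_mono) blast

text \<open>By monotonicity each term of the derived series of \<open>S\<close> lies in the
  corresponding term for \<open>T\<close>, and each contains 0; so it is {0} as soon as the latter
  is.\<close>

lemma solvable_subset:
  assumes "solvable T" "S \<subseteq> T" "0 \<in> S"
  shows "solvable S"
proof -
  obtain n where n: "(derived_algebra ^^ n) T = {0}"
    using assms(1) by (auto simp: solvable_def)
  have "(derived_algebra ^^ m) S \<subseteq> (derived_algebra ^^ m) T" for m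
    using assms(2) by (induction m) (auto intro: derived_algebra_mono[THEN subsetD])
  moreover have "0 \<in> (derived_algebra ^^ m) S" for m
    using assms(3) by (cases m) (auto simp: derived_algebra_def span_zero)
  ultimately have "(derived_algebra ^^ n) S = {0}"
    using n by blast
  then show ?thesis
    by (auto simp: solvable_def)
qed

lemma lie_subalgebra_Inter:
  assumes "\<And>S. S \<in> F \<Longrightarrow> lie_subalgebra S" "F \<noteq> {}"
  shows "lie_subalgebra (\<Inter>F)"
  using assms unfolding lie_subalgebra_def
  by (auto intro!: subspace_Inter)

lemma lie_subalgebra_carrier: "lie_subalgebra L"
  by (simp add: lie_subalgebra_def subspace_carrier bracket_closed)

lemma lie_subalgebra_generated:
  assumes "X \<subseteq> L"
  shows "lie_subalgebra (generated X)"
  unfolding generated_def hull_def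
  using assms lie_subalgebra_carrier by (intro lie_subalgebra_Inter) auto

lemma generated_subset: "X \<subseteq> generated X"
  by (simp add: generated_def hull_subset)

lemma generated_minimal: "X \<subseteq> S \<Longrightarrow> lie_subalgebra S \<Longrightarrow> generated X \<subseteq> S"
  by (simp add: generated_def hull_minimal)

text \<open>The span of \<open>x, y\<close> is itself a subalgebra here, its derived algebra lies in
  the line through \<open>bracket x y\<close>, and brackets within a line vanish. Hence the second
  derived algebra is zero, and \<open>generated {x, y}\<close> inherits solvability from the
  span.\<close>

lemma solvable_generated_pair:
  assumes x: "x \<in> L" and y: "y \<in> L" and xy: "bracket x y \<in> span {x, y}"
  shows "solvable (generated {x, y})"
proof -
  define S where "S = span {x, y}"
  have comb: "\<exists>a b. v = scale a x + scale b y" if "v \<in> S" for v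
    using that unfolding S_def by (auto simp: span_insert span_singleton)
      (metis add.commute diff_add_cancel)
  have scL: "scale a z \<in> L" if "z \<in> L" for a z
    using that subspace_carrier subspace_scale by blast
  have zero: "bracket x x = 0" "bracket y y = 0"
    using x y by (simp_all add: bracket_self)
  have "bracket (x + y) (x + y) = 0"
    using x y subspace_carrier by (simp add: bracket_self subspace_add)
  then have yx: "bracket y x = - bracket x y"
    using x y subspace_carrier zero
    by (simp add: bracket_add_left bracket_add_right subspace_add eq_neg_iff_add_eq_0 add.commute)
  \<comment> \<open>Bilinearity and antisymmetry leave only the determinant of the coefficients
    times \<open>bracket x y\<close>.\<close>
  have br: "bracket u v \<in> span {bracket x y}" if uv: "u \<in> S" "v \<in> S" for u v
  proof -
    obtain a b c d where "u = scale a x + scale b y" "v = scale c x + scale d y"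
      using comb uv by meson
    then have "bracket u v = scale (a * d - b * c) (bracket x y)"
      using x y scL subspace_carrier zero
      by (simp add: bracket_add_left bracket_add_right subspace_add bracket_scale_left
          bracket_scale_right yx scale_left_diff_distrib algebra_simps)
    then show ?thesis
      by (simp add: span_base span_scale)
  qed
  have S: "lie_subalgebra S"
    unfolding lie_subalgebra_def
  proof (intro conjI ballI)
    show "subspace S" by (simp add: S_def)
    show "S \<subseteq> L" using x y by (simp add: S_def span_minimal subspace_carrier)
    fix u v assume "u \<in> S" "v \<in> S"
    then show "bracket u v \<in> S"
      using br xy unfolding S_def by (meson empty_subsetI insert_subset span_minimal subsetD subspace_span)
  qed
  have D1: "derived_algebra S \<subseteq> span {bracket x y}"
    unfolding derived_algebra_def using br by (intro span_minimal) auto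
  have z: "bracket x y \<in> L"
    using x y bracket_closed by blast
  have "bracket u v = 0" if "u \<in> span {bracket x y}" "v \<in> span {bracket x y}" for u v
    using that z scL by (auto simp: span_singleton bracket_scale_left bracket_scale_right bracket_self)
  then have "derived_algebra (derived_algebra S) \<subseteq> span {0}"
    unfolding derived_algebra_def[of "derived_algebra S"] using D1 by (intro span_mono) blast
  then have "derived_algebra (derived_algebra S) = {0}"
    using span_zero unfolding derived_algebra_def[of "derived_algebra S"] by auto
  then have "solvable S"
    unfolding solvable_def by (intro exI[of _ 2]) (simp add: numeral_2_eq_2)
  moreover have "generated {x, y} \<subseteq> S"
    using S by (intro generated_minimal) (auto simp: S_def span_base)
  moreover have "0 \<in> generated {x, y}"
    using lie_subalgebra_generated[of "{x, y}"] x y subspace_0 by (auto simp: lie_subalgebra_def)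
  ultimately show ?thesis
    by (rule solvable_subset)
qed

end

section \<open>Coordinates on \<open>sl2\<close> and the discriminant\<close>

definition sl2_mat :: "'a::field \<Rightarrow> 'a \<Rightarrow> 'a \<Rightarrow> 'a^2^2" where
  "sl2_mat a b c = vector [vector [a, b], vector [c, - a]]"

lemma sl2_mat_nth [simp]:
  "sl2_mat a b c $ 1 $ 1 = a" "sl2_mat a b c $ 1 $ 2 = b"
  "sl2_mat a b c $ 2 $ 1 = c" "sl2_mat a b c $ 2 $ 2 = - a"
  by (simp_all add: sl2_mat_def)

lemma sl2_mat_in_sl2 [simp]: "sl2_mat a b c \<in> sl2"
  by (simp add: sl2_def trace_def sum_2)

lemma sl2_mat_eq_iff [simp]: "sl2_mat a b c = sl2_mat a' b' c' \<longleftrightarrow> a = a' \<and> b = b' \<and> c = c'"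
  by (auto simp: mat2_eq_iff)

lemma sl2_mat_eq_0_iff [simp]: "sl2_mat a b c = 0 \<longleftrightarrow> a = 0 \<and> b = 0 \<and> c = 0"
  by (auto simp: mat2_eq_iff)

lemma sl2_cases:
  assumes "x \<in> sl2"
  obtains a b c where "x = sl2_mat a b c"
proof
  show "x = sl2_mat (x$1$1) (x$1$2) (x$2$1)"
    using assms by (simp add: mat2_eq_iff sl2_def trace_def sum_2 eq_neg_iff_add_eq_0 add.commute)
qed

lemma sl2_mat_add: "sl2_mat a b c + sl2_mat a' b' c' = sl2_mat (a + a') (b + b') (c + c')"
  by (simp add: mat2_eq_iff)

lemma mat_scale_sl2_mat: "mat_scale t (sl2_mat a b c) = sl2_mat (t * a) (t * b) (t * c)"
  by (simp add: mat2_simps)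

lemma mat_commutator_sl2_mat:
  "mat_commutator (sl2_mat a b c) (sl2_mat a' b' c') =
     sl2_mat (b * c' - b' * c) (2 * (a * b' - a' * b)) (2 * (c * a' - c' * a))"
  by (simp add: mat2_simps algebra_simps)

text \<open>A traceless matrix has characteristic polynomial X^2 - \<open>discr A\<close>, so its
  eigenvalues are the square roots of \<open>discr A\<close>.\<close>

definition discr :: "'a::field^2^2 \<Rightarrow> 'a" where
  "discr A = (A$1$1)\<^sup>2 + A$1$2 * A$2$1"

lemma discr_sl2_mat [simp]: "discr (sl2_mat a b c) = a\<^sup>2 + b * c"
  by (simp add: discr_def)

section \<open>The criterion for two elements of \<open>sl2\<close> to generate a solvable
  subalgebra\<close>

lemma in_span_pairI: "z = mat_scale s x + mat_scale t y \<Longrightarrow> z \<in> sl2.span {x, y}"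
  by (simp add: sl2.span_add sl2.span_scale sl2.span_base)

lemma eq_combination_divide:
  fixes w :: "'a::field"
  assumes "w * p = s * a + t * b" "p \<noteq> 0"
  shows "w = s / p * a + t / p * b"
  using assms by (simp add: field_simps)

lemma four_neq_0: "(2::'a::field) \<noteq> 0 \<Longrightarrow> (4::'a) \<noteq> 0"
  using no_zero_divisors[of "2::'a" 2] by simp

lemma solvable_generated_iff:
  fixes x y :: "'a::field^2^2"
  assumes two: "(2::'a) \<noteq> 0" and x: "x \<in> sl2" and y: "y \<in> sl2"
  shows "sl2.solvable (sl2.generated {x, y}) \<longleftrightarrow> discr (mat_commutator x y) = 0"
proof -
  obtain a b c where xe: "x = sl2_mat a b c" by (rule sl2_cases[OF x])
  obtain a' b' c' where ye: "y = sl2_mat a' b' c'" by (rule sl2_cases[OF y])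
  \<comment> \<open>The triple (p, s, r) is the cross product of (a, b, c) and (a', b', c'), hence
    orthogonal to both. Its dot product with the coordinates (p, 2r, 2s) of the bracket is the
    determinant p^2 + 4rs of \<open>x, y, [x, y]\<close>, which is also the discriminant of the
    bracket.\<close>
  define p r s where "p = b * c' - b' * c" and "r = a * b' - a' * b" and "s = c * a' - c' * a"
  have z: "mat_commutator x y = sl2_mat p (2 * r) (2 * s)"
    by (simp add: xe ye mat_commutator_sl2_mat p_def r_def s_def)
  have orth: "a * p + b * s + c * r = 0" "a' * p + b' * s + c' * r = 0"
    by (simp_all add: p_def r_def s_def algebra_simps)
  show ?thesis
  proof
    assume "discr (mat_commutator x y) = 0"
    then have eq: "p * p + 4 * (r * s) = 0"
      by (simp add: z power2_eq_square algebra_simps)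
    have "mat_commutator x y \<in> sl2.span {x, y}"
    proof (cases "p = 0")
      case False
      \<comment> \<open>The coefficients come from Cramer's rule for the second and third
        coordinates, whose minor is \<open>p\<close>. The vanishing of the determinant is what makes
        them fit the first coordinate too.\<close>
      have "p * p = (2 * r * c' - 2 * s * b') * a + (2 * s * b - 2 * r * c) * a'"
        using eq unfolding p_def r_def s_def by algebra
      then have "p = ((2 * r * c' - 2 * s * b') / p) * a + ((2 * s * b - 2 * r * c) / p) * a'"
        using False by (rule eq_combination_divide)
      moreover have "2 * r * p = (2 * r * c' - 2 * s * b') * b + (2 * s * b - 2 * r * c) * b'"
        unfolding p_def by algebra
      then have "2 * r = ((2 * r * c' - 2 * s * b') / p) * b + ((2 * s * b - 2 * r * c) / p) * b'"
        using False by (rule eq_combination_divide)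
      moreover have "2 * s * p = (2 * r * c' - 2 * s * b') * c + (2 * s * b - 2 * r * c) * c'"
        unfolding p_def by algebra
      then have "2 * s = ((2 * r * c' - 2 * s * b') / p) * c + ((2 * s * b - 2 * r * c) / p) * c'"
        using False by (rule eq_combination_divide)
      ultimately show ?thesis
        unfolding z unfolding xe ye
        by (intro in_span_pairI[where s = "(2 * r * c' - 2 * s * b') / p"
              and t = "(2 * s * b - 2 * r * c) / p"])
          (simp add: mat_scale_sl2_mat sl2_mat_add)
    next
      case p0: True
      \<comment> \<open>Now rs = 0. If just one of \<open>r, s\<close> is nonzero, orthogonality
        makes \<open>x\<close> and \<open>y\<close> both upper or both lower triangular, and
        cancelling their diagonals gives the bracket; if both vanish, the bracket is 0.\<close>
      with eq four_neq_0[OF two] have rs: "r = 0 \<or> s = 0" by simp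
      show ?thesis
      proof (cases "r = 0")
        case False
        with rs p0 orth have *: "s = 0" "c = 0" "c' = 0" by auto
        show ?thesis
          unfolding z unfolding xe ye using * p0
          by (intro in_span_pairI[where s = "- 2 * a'" and t = "2 * a"])
            (simp add: mat_scale_sl2_mat sl2_mat_add r_def algebra_simps)
      next
        case r0: True
        show ?thesis
        proof (cases "s = 0")
          case True
          then show ?thesis
            unfolding z unfolding xe ye using p0 r0
            by (intro in_span_pairI[where s = 0 and t = 0]) (simp add: mat_scale_sl2_mat sl2_mat_add)
        next
          case False
          with r0 p0 orth have *: "b = 0" "b' = 0" by auto
          show ?thesis
            unfolding z unfolding xe ye using * p0 r0
            by (intro in_span_pairI[where s = "2 * a'" and t = "- 2 * a"])
              (simp add: mat_scale_sl2_mat sl2_mat_add s_def algebra_simps)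
        qed
      qed
    qed
    then show "sl2.solvable (sl2.generated {x, y})"
      using x y by (rule sl2.solvable_generated_pair[rotated 2])
  next
    assume solv: "sl2.solvable (sl2.generated {x, y})"
    show "discr (mat_commutator x y) = 0"
    proof (rule ccontr)
      assume "discr (mat_commutator x y) \<noteq> 0"
      define d where "d = p * p + 4 * (r * s)"
      have d: "d \<noteq> 0"
        using \<open>discr (mat_commutator x y) \<noteq> 0\<close>
        by (simp add: z d_def power2_eq_square algebra_simps)
      let ?S = "sl2.generated {x, y}"
      have sub: "sl2.lie_subalgebra ?S"
        using x y by (intro sl2.lie_subalgebra_generated) auto
      have xS: "x \<in> ?S" and yS: "y \<in> ?S"
        using sl2.generated_subset[of "{x, y}"] by auto
      then have zS: "mat_commutator x y \<in> ?S"
        using sub by (auto simp: sl2.lie_subalgebra_def)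
      have "v \<in> ?S" if v: "v \<in> sl2" for v
      proof -
        obtain a3 b3 c3 where ve: "v = sl2_mat a3 b3 c3" by (rule sl2_cases[OF v])
        \<comment> \<open>Cramer's rule for the basis \<open>x, y, [x, y]\<close>.\<close>
        define t1 where "t1 = a3 * (b' * 2 * s - c' * 2 * r)
          - a' * (b3 * 2 * s - c3 * 2 * r) + p * (b3 * c' - c3 * b')"
        define t2 where "t2 = a * (b3 * 2 * s - c3 * 2 * r)
          - a3 * (b * 2 * s - c * 2 * r) + p * (b * c3 - c * b3)"
        define t3 where "t3 = a3 * p + b3 * s + c3 * r"
        have "d * a3 = t1 * a + t2 * a' + t3 * p" "d * b3 = t1 * b + t2 * b' + t3 * (2 * r)"
          "d * c3 = t1 * c + t2 * c' + t3 * (2 * s)"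
          unfolding d_def t1_def t2_def t3_def p_def r_def s_def by algebra+
        then have "v = mat_scale (t1 / d) x +
            (mat_scale (t2 / d) y + mat_scale (t3 / d) (mat_commutator x y))"
          using d unfolding z unfolding xe ye ve by (simp add: mat_scale_sl2_mat sl2_mat_add field_simps)
        also have "\<dots> \<in> ?S"
          using sub xS yS zS
          by (auto simp: sl2.lie_subalgebra_def intro!: sl2.subspace_add sl2.subspace_scale)
        finally show ?thesis .
      qed
      then have "sl2 \<subseteq> ?S" by blast
      with solv have "sl2.solvable (sl2 :: ('a^2^2) set)"
        by (rule sl2.solvable_subset) (simp add: sl2.subspace_0 sl2.subspace_carrier)
      with two show False by (simp add: solvable_sl2_iff)
    qed
  qed
qed

section \<open>The size of the set of elements generating a solvable subalgebra with a given
  one\<close>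

definition solvable_nbhd :: "'a::field^2^2 \<Rightarrow> ('a^2^2) set" where
  "solvable_nbhd x = {y \<in> sl2. discr (mat_commutator x y) = 0}"

lemma sl2_mat_in_solvable_nbhd_iff:
  "sl2_mat a' b' c' \<in> solvable_nbhd (sl2_mat a b c) \<longleftrightarrow>
     (b * c' - b' * c)\<^sup>2 + 2 * (a * b' - a' * b) * (2 * (c * a' - c' * a)) = 0"
  by (simp add: solvable_nbhd_def mat_commutator_sl2_mat)

text \<open>The zero set of the binary form u^2 - D r^2, to which the condition on \<open>y\<close>
  reduces after a linear change of coordinates.\<close>

definition square_ratio_pairs :: "'a::field \<Rightarrow> ('a \<times> 'a) set" where
  "square_ratio_pairs D = {(r, u). u\<^sup>2 = r\<^sup>2 * D}"

text \<open>The trace of x [x, y] vanishes. As \<open>b\<close> is nonzero, this eliminates the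
  lower left entry of the bracket, and completing the square turns b^2 \<open>discr\<close> [x, y]
  into u^2 - r^2 \<open>discr x\<close>. The upper right entry of \<open>y\<close> remains free and
  contributes the factor \<open>CARD('a)\<close>.\<close>

lemma card_solvable_nbhd_upper:
  fixes a b c :: "'a::{field,finite}"
  assumes two: "(2::'a) \<noteq> 0" and b: "b \<noteq> 0"
  shows "card (solvable_nbhd (sl2_mat a b c)) =
           CARD('a) * card (square_ratio_pairs (a\<^sup>2 + b * c))"
proof -
  let ?x = "sl2_mat a b c"
  define f where "f = (\<lambda>y::'a^2^2. let r = 2 * (a * y$1$2 - y$1$1 * b) in
    (y$1$2, r, b * (b * y$2$1 - y$1$2 * c) - a * r))"
  define g where "g = (\<lambda>(b', r, u). sl2_mat ((a * b' - r / 2) / b) b' (((u + a * r) / b + b' * c) / b))"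
  have key: "b\<^sup>2 * ((b * c' - b' * c)\<^sup>2 + 2 * (a * b' - a' * b) * (2 * (c * a' - c' * a))) =
      (b * (b * c' - b' * c) - a * (2 * (a * b' - a' * b)))\<^sup>2
      - (2 * (a * b' - a' * b))\<^sup>2 * (a\<^sup>2 + b * c)" for a' b' c'
    by algebra
  have iff: "sl2_mat a' b' c' \<in> solvable_nbhd ?x \<longleftrightarrow>
      (2 * (a * b' - a' * b), b * (b * c' - b' * c) - a * (2 * (a * b' - a' * b)))
        \<in> square_ratio_pairs (a\<^sup>2 + b * c)" for a' b' c'
    using key[of c' b' a'] b
    by (simp only: sl2_mat_in_solvable_nbhd_iff square_ratio_pairs_def mem_Collect_eq prod.case)
      (metis eq_iff_diff_eq_0 mult_eq_0_iff power_not_zero)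
  have fg: "f (g t) = t" for t
    using two b by (cases t) (simp add: f_def g_def Let_def field_simps)
  have gf: "g (f y) = y" if y: "y \<in> sl2" for y
  proof -
    obtain a' b' c' where "y = sl2_mat a' b' c'" by (rule sl2_cases[OF y])
    then show ?thesis
      using two b by (simp add: f_def g_def Let_def field_simps)
  qed
  have mem: "y \<in> solvable_nbhd ?x \<longleftrightarrow> f y \<in> UNIV \<times> square_ratio_pairs (a\<^sup>2 + b * c)"
    if y: "y \<in> sl2" for y
  proof -
    obtain a' b' c' where "y = sl2_mat a' b' c'" by (rule sl2_cases[OF y])
    then show ?thesis
      by (simp add: f_def Let_def iff)
  qed
  have gsl: "g t \<in> sl2" for t
    by (cases t) (simp add: g_def)
  have "bij_betw f (solvable_nbhd ?x) (UNIV \<times> square_ratio_pairs (a\<^sup>2 + b * c))"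
  proof (rule bij_betw_byWitness[where f' = g])
    show "\<forall>y\<in>solvable_nbhd ?x. g (f y) = y"
      by (simp add: gf solvable_nbhd_def)
    show "\<forall>t\<in>UNIV \<times> square_ratio_pairs (a\<^sup>2 + b * c). f (g t) = t"
      by (simp add: fg)
    show "f ` solvable_nbhd ?x \<subseteq> UNIV \<times> square_ratio_pairs (a\<^sup>2 + b * c)"
      using mem by (force simp: solvable_nbhd_def)
    show "g ` (UNIV \<times> square_ratio_pairs (a\<^sup>2 + b * c)) \<subseteq> solvable_nbhd ?x"
      using mem[OF gsl] fg by auto
  qed
  then show ?thesis
    by (simp add: bij_betw_same_card card_cartesian_product)
qed

text \<open>Here the form is -4 a^2 b' c'. Passing to the sum and difference of b' and c' gives u^2
  - r^2 a^2, while a' is free.\<close>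

lemma card_solvable_nbhd_diag:
  fixes a :: "'a::{field,finite}"
  assumes two: "(2::'a) \<noteq> 0" and a: "a \<noteq> 0"
  shows "card (solvable_nbhd (sl2_mat a 0 0)) = CARD('a) * card (square_ratio_pairs (a\<^sup>2))"
proof -
  let ?x = "sl2_mat a 0 0"
  define f where "f = (\<lambda>y::'a^2^2. (y$1$1, y$1$2 + y$2$1, a * (y$1$2 - y$2$1)))"
  define g where "g = (\<lambda>(a', r, u). sl2_mat a' ((r + u / a) / 2) ((r - u / a) / 2))"
  have fg: "f (g t) = t" for t
    using two a four_neq_0[OF two] by (cases t) (simp add: f_def g_def field_simps)
  have gf: "g (f y) = y" if y: "y \<in> sl2" for y
  proof -
    obtain a' b' c' where "y = sl2_mat a' b' c'" by (rule sl2_cases[OF y])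
    then show ?thesis
      using two a by (simp add: f_def g_def field_simps)
  qed
  have "(a * (b' - c'))\<^sup>2 - (b' + c')\<^sup>2 * a\<^sup>2 = 2 * (a * b') * (2 * (- (c' * a)))" for b' c'
    by algebra
  then have key: "(a * (b' - c'))\<^sup>2 = (b' + c')\<^sup>2 * a\<^sup>2 \<longleftrightarrow> 2 * (a * b') * (2 * (- (c' * a))) = 0" for b' c'
    by (subst eq_iff_diff_eq_0) (simp only:)
  have mem: "y \<in> solvable_nbhd ?x \<longleftrightarrow> f y \<in> UNIV \<times> square_ratio_pairs (a\<^sup>2)"
    if y: "y \<in> sl2" for y
  proof -
    obtain a' b' c' where y': "y = sl2_mat a' b' c'" by (rule sl2_cases[OF y])
    show ?thesis
      unfolding y' sl2_mat_in_solvable_nbhd_iff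
      by (simp add: f_def square_ratio_pairs_def key)
  qed
  have gsl: "g t \<in> sl2" for t
    by (cases t) (simp add: g_def)
  have "bij_betw f (solvable_nbhd ?x) (UNIV \<times> square_ratio_pairs (a\<^sup>2))"
  proof (rule bij_betw_byWitness[where f' = g])
    show "\<forall>y\<in>solvable_nbhd ?x. g (f y) = y"
      by (simp add: gf solvable_nbhd_def)
    show "\<forall>t\<in>UNIV \<times> square_ratio_pairs (a\<^sup>2). f (g t) = t"
      by (simp add: fg)
    show "f ` solvable_nbhd ?x \<subseteq> UNIV \<times> square_ratio_pairs (a\<^sup>2)"
      using mem by (force simp: solvable_nbhd_def)
    show "g ` (UNIV \<times> square_ratio_pairs (a\<^sup>2)) \<subseteq> solvable_nbhd ?x"
      using mem[OF gsl] fg by auto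
  qed
  then show ?thesis
    by (simp add: bij_betw_same_card card_cartesian_product)
qed

lemma transpose_sl2_mat [simp]: "transpose (sl2_mat a b c) = sl2_mat a c b"
  by (simp add: mat2_eq_iff transpose_def)

text \<open>Transposition reverses brackets and preserves \<open>discr\<close>. It exchanges the
  off-diagonal entries, so a nonzero lower left entry reduces to a nonzero upper right one.\<close>

lemma card_solvable_nbhd_transpose:
  fixes x :: "'a::field^2^2"
  assumes x: "x \<in> sl2"
  shows "card (solvable_nbhd (transpose x)) = card (solvable_nbhd x)"
proof -
  have 1: "transpose y \<in> solvable_nbhd (transpose x)"
    if x: "x \<in> sl2" and y: "y \<in> solvable_nbhd x" for x y :: "'a^2^2"
  proof -
    obtain a b c where x': "x = sl2_mat a b c" by (rule sl2_cases[OF x])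
    have "y \<in> sl2" using y by (simp add: solvable_nbhd_def)
    then obtain a' b' c' where y': "y = sl2_mat a' b' c'" by (rule sl2_cases)
    show ?thesis
      using y unfolding x' y' transpose_sl2_mat sl2_mat_in_solvable_nbhd_iff by algebra
  qed
  have "transpose x \<in> sl2"
    using x by (auto elim!: sl2_cases)
  then have "bij_betw transpose (solvable_nbhd x) (solvable_nbhd (transpose x))"
    using 1[OF x] 1[of "transpose x"]
    by (intro bij_betw_byWitness[where f' = transpose]) (auto simp: transpose_transpose)
  then show ?thesis
    by (simp add: bij_betw_same_card)
qed

lemma card_solvable_nbhd:
  fixes x :: "'a::{field,finite}^2^2"
  assumes two: "(2::'a) \<noteq> 0" and x: "x \<in> sl2" "x \<noteq> 0"
  shows "card (solvable_nbhd x) = CARD('a) * card (square_ratio_pairs (discr x))"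
proof -
  obtain a b c where x': "x = sl2_mat a b c" by (rule sl2_cases[OF x(1)])
  consider "b \<noteq> 0" | "c \<noteq> 0" | "a \<noteq> 0" "b = 0" "c = 0"
    using x x' by auto
  then show ?thesis
  proof cases
    case 1
    then show ?thesis by (simp add: x' card_solvable_nbhd_upper[OF two])
  next
    case 2
    then show ?thesis
      using card_solvable_nbhd_upper[OF two, of c a b] card_solvable_nbhd_transpose[OF x(1)]
      by (simp add: x' mult.commute)
  next
    case 3
    then show ?thesis by (simp add: x' card_solvable_nbhd_diag[OF two])
  qed
qed

section \<open>Counting ratio pairs, elements of given discriminant, and squares\<close>

lemma card_square_ratio_pairs_0: "card (square_ratio_pairs (0::'a::{field,finite})) = CARD('a)"
proof -
  have "square_ratio_pairs (0::'a) = UNIV \<times> {0}"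
    by (auto simp: square_ratio_pairs_def)
  then show ?thesis by (simp add: card_cartesian_product)
qed

text \<open>Two lines of slopes d and -d, which meet only in the origin because 2 is
  nonzero.\<close>

lemma card_square_ratio_pairs_square:
  fixes d :: "'a::{field,finite}"
  assumes two: "(2::'a) \<noteq> 0" and d: "d \<noteq> 0"
  shows "card (square_ratio_pairs (d\<^sup>2)) = 2 * CARD('a) - 1"
proof -
  let ?A = "range (\<lambda>r. (r, r * d))" and ?B = "range (\<lambda>r. (r, - (r * d)))"
  have eq: "square_ratio_pairs (d\<^sup>2) = ?A \<union> ?B"
    by (auto simp: square_ratio_pairs_def power2_eq_iff simp flip: power_mult_distrib)
  have r0: "r = 0" if "r * d = - (r * d)" for r
  proof -
    have "2 * (r * d) = 0"
      using that by (metis add.right_inverse mult_2)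
    with two d show ?thesis by simp
  qed
  have "?A \<inter> ?B = {(0, 0)}"
  proof (intro equalityI subsetI)
    fix t assume "t \<in> ?A \<inter> ?B"
    then obtain r where t: "t = (r, r * d)" and "r * d = - (r * d)"
      by blast
    from this(2) have "r = 0" by (rule r0)
    with t show "t \<in> {(0, 0)}" by simp
  next
    show "t \<in> ?A \<inter> ?B" if "t \<in> {(0, 0)}" for t
      using that by (auto intro!: range_eqI[of _ _ 0])
  qed
  then have I: "card (?A \<inter> ?B) = 1"
    by simp
  have A: "card ?A = CARD('a)"
    by (rule card_image) (simp add: inj_def)
  have B: "card ?B = CARD('a)"
    by (rule card_image) (simp add: inj_def)
  have "card ?A + card ?B = card (square_ratio_pairs (d\<^sup>2)) + card (?A \<inter> ?B)"
    unfolding eq by (rule card_Un_Int) (rule finite_imageI[OF finite])+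
  then show ?thesis
    unfolding I A B by linarith
qed

lemma square_ratio_pairs_nonsquare:
  fixes D :: "'a::field"
  assumes "\<And>d. D \<noteq> d\<^sup>2"
  shows "square_ratio_pairs D = {(0, 0)}"
proof -
  have "r = 0" if "u\<^sup>2 = r\<^sup>2 * D" for r u
  proof (rule ccontr)
    assume "r \<noteq> 0"
    with that have "D = (u / r)\<^sup>2"
      by (simp add: power_divide)
    with assms show False by blast
  qed
  then show ?thesis
    by (fastforce simp: square_ratio_pairs_def)
qed

text \<open>If the upper right entry b is nonzero, then b, a and the value D in \<open>T\<close>
  determine the last entry; if b = 0, the discriminant is a^2 and the last entry is free. A set
  \<open>T\<close> of values covers squares, zero and nonsquares at once.\<close>

lemma card_discr_in:
  fixes T :: "'a::{field,finite} set"
  shows "card {x \<in> sl2. discr x \<in> T} =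
    (CARD('a) - 1) * CARD('a) * card T + CARD('a) * card {a. a\<^sup>2 \<in> T}"
proof -
  define f where "f = (\<lambda>(b::'a, a, D). sl2_mat a b ((D - a\<^sup>2) / b))"
  define g where "g = (\<lambda>(a::'a, c). sl2_mat a 0 c)"
  let ?A = "(- {0}) \<times> UNIV \<times> T" and ?B = "{a. a\<^sup>2 \<in> T} \<times> UNIV"
  have "{x \<in> sl2. discr x \<in> T} = f ` ?A \<union> g ` ?B"
  proof (intro equalityI subsetI)
    fix x assume "x \<in> {x \<in> sl2. discr x \<in> T}"
    then have x: "x \<in> sl2" "discr x \<in> T" by auto
    obtain a b c where x': "x = sl2_mat a b c" by (rule sl2_cases[OF x(1)])
    show "x \<in> f ` ?A \<union> g ` ?B"
    proof (cases "b = 0")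
      case True
      then have "x = g (a, c)" "(a, c) \<in> ?B"
        using x by (auto simp: x' g_def)
      then show ?thesis by blast
    next
      case False
      then have "x = f (b, a, discr x)" "(b, a, discr x) \<in> ?A"
        using x by (auto simp: x' f_def)
      then show ?thesis by blast
    qed
  qed (auto simp: f_def g_def)
  moreover have "f ` ?A \<inter> g ` ?B = {}"
    by (auto simp: f_def g_def)
  moreover have "inj_on f ?A"
    by (auto simp: inj_on_def f_def)
  moreover have "inj_on g ?B"
    by (auto simp: inj_on_def g_def)
  moreover have "card (- {0::'a}) = CARD('a) - 1"
    by (simp add: Compl_eq_Diff_UNIV)
  ultimately show ?thesis
    by (simp add: card_Un_disjoint card_image card_cartesian_product)
qed

text \<open>Squaring is two-to-one on the nonzero elements, with fibres {d, -d}.\<close>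

lemma card_nonzero_squares:
  assumes two: "(2::'a::{field,finite}) \<noteq> 0"
  shows "2 * card {d\<^sup>2 | d::'a. d \<noteq> 0} = CARD('a) - 1"
proof -
  let ?S = "{d\<^sup>2 | d::'a. d \<noteq> 0}"
  have fib: "card {d::'a. d\<^sup>2 = s} = 2" if s: "s \<in> ?S" for s
  proof -
    obtain d where d: "s = d\<^sup>2" "d \<noteq> 0" using s by blast
    then have "{d. d\<^sup>2 = s} = {d, - d}"
      by (auto simp: power2_eq_iff)
    moreover have "d \<noteq> - d"
      using d two by (metis add.right_inverse mult_2 mult_eq_0_iff)
    ultimately show ?thesis by simp
  qed
  have "- {0::'a} = (\<Union>s\<in>?S. {d. d\<^sup>2 = s})"
    by auto
  then have "card (- {0::'a}) = card (\<Union>s\<in>?S. {d::'a. d\<^sup>2 = s})"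
    by simp
  also have "\<dots> = (\<Sum>s\<in>?S. card {d::'a. d\<^sup>2 = s})"
    by (intro card_UN_disjoint) auto
  also have "\<dots> = 2 * card ?S"
    using fib by simp
  finally show ?thesis
    by (simp add: Compl_eq_Diff_UNIV)
qed

section \<open>Vertices and degrees of the solvable graph\<close>

lemma in_solvable_nbhd_iff:
  fixes x y :: "'a::field^2^2"
  assumes "(2::'a) \<noteq> 0" "x \<in> sl2"
  shows "y \<in> solvable_nbhd x \<longleftrightarrow> y \<in> sl2 \<and> sl2.solvable (sl2.generated {x, y})"
  using assms by (auto simp: solvable_nbhd_def solvable_generated_iff)

lemma solvabilizer_sl2:
  assumes two: "(2::'a::field) \<noteq> 0"
  shows "sl2.solvabilizer = {0 :: 'a^2^2}"
proof -
  have *: "x = 0" if x: "x \<in> sl2" "\<And>h. h \<in> sl2 \<Longrightarrow> discr (mat_commutator h x) = 0" for x :: "'a^2^2"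
  proof -
    obtain a b c where x': "x = sl2_mat a b c" by (rule sl2_cases[OF x(1)])
    \<comment> \<open>Testing against the two off-diagonal matrix units gives the discriminants b^2
      and c^2; once these vanish, testing against their sum gives -4 a^2.\<close>
    have b: "b = 0" and c: "c = 0"
      using x(2)[of "sl2_mat 0 0 1"] x(2)[of "sl2_mat 0 1 0"]
      by (simp_all add: x' mat_commutator_sl2_mat)
    then have "a = 0"
      using x(2)[of "sl2_mat 0 1 1"] four_neq_0[OF two] by (simp add: x' mat_commutator_sl2_mat)
    with b c show ?thesis by (simp add: x')
  qed
  have zero: "(0::'a^2^2) \<in> sl2"
    by (rule sl2.subspace_0[OF sl2.subspace_carrier])
  then have "(0::'a^2^2) \<in> sl2.solvabilizer"
    using solvable_generated_iff[OF two _ zero]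
    by (simp add: sl2.solvabilizer_def mat_commutator_def discr_def)
  moreover have "sl2.solvabilizer \<subseteq> {0 :: 'a^2^2}"
    using * by (auto simp: sl2.solvabilizer_def solvable_generated_iff[OF two])
  ultimately show ?thesis by blast
qed

text \<open>The 2 accounts for 0, which is not a vertex, and for \<open>x\<close> itself, as there
  are no loops.\<close>

lemma out_degree_solvable_graph:
  fixes x :: "'a::{field,finite}^2^2"
  assumes two: "(2::'a) \<noteq> 0" and x: "x \<in> sl2" "x \<noteq> 0"
  shows "out_degree (with_proj sl2.solvable_graph) x = card (solvable_nbhd x) - 2"
proof -
  have "out_arcs (with_proj sl2.solvable_graph) x = Pair x ` (solvable_nbhd x - {0, x})"
    using x by (auto simp: out_arcs_def sl2.solvable_graph_def solvabilizer_sl2[OF two]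
        in_solvable_nbhd_iff[OF two])
  then have "out_degree (with_proj sl2.solvable_graph) x = card (solvable_nbhd x - {0, x})"
    by (simp add: out_degree_def card_image inj_on_def)
  moreover have "{0, x} \<subseteq> solvable_nbhd x"
    using x by (auto simp: solvable_nbhd_def sl2.bracket_self discr_def sl2.subspace_0
        sl2.subspace_carrier mat_commutator_def)
  ultimately show ?thesis
    using x by (simp add: card_Diff_subset)
qed

text \<open>The line through \<open>x\<close> lies in the neighbourhood, and both have
  \<open>CARD('a)\<close> elements because (0, 0) is the only ratio pair.\<close>

lemma solvable_nbhd_nonsquare:
  fixes x :: "'a::{field,finite}^2^2"
  assumes two: "(2::'a) \<noteq> 0" and x: "x \<in> sl2" and ns: "\<And>d. discr x \<noteq> d\<^sup>2"
  shows "solvable_nbhd x = range (\<lambda>t. mat_scale t x)"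
proof (rule card_subset_eq[symmetric])
  obtain a b c where x': "x = sl2_mat a b c" by (rule sl2_cases[OF x])
  have "x \<noteq> 0"
    using ns[of 0] by (auto simp: discr_def)
  then have "inj (\<lambda>t. mat_scale t x)"
    by (auto simp: inj_def x' mat_scale_sl2_mat)
  then show "card (range (\<lambda>t. mat_scale t x)) = card (solvable_nbhd x)"
    using card_solvable_nbhd[OF two x \<open>x \<noteq> 0\<close>]
    by (simp add: card_image square_ratio_pairs_nonsquare[OF ns])
  show "range (\<lambda>t. mat_scale t x) \<subseteq> solvable_nbhd x"
    by (auto simp: x' mat_scale_sl2_mat sl2_mat_in_solvable_nbhd_iff algebra_simps)
qed simp

text \<open>The vertices are split by discriminant into nonzero square (\<open>VS\<close>), zero
  (\<open>VZ\<close>) and nonsquare (\<open>VN\<close>); the degree is constant on each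
  class.\<close>

lemma degree_sequence_sl2:
  fixes G :: "('a::{field,finite}^2^2) pair_pre_digraph"
  assumes two: "(2::'a) \<noteq> 0" and q: "q = CARD('a)" and G: "G = sl2.solvable_graph"
  shows "degree_sequence G =
    replicate_mset (q * (q^2 - 1) div 2) (2 * q^2 - q - 2) +
    replicate_mset (q^2 - 1) (q^2 - 2) +
    replicate_mset (q * (q - 1)^2 div 2) (q - 2)"
proof -
  define S N where "S = {d\<^sup>2 | d::'a. d \<noteq> 0}" and "N = {D::'a. \<forall>d. D \<noteq> d\<^sup>2}"
  define VS VZ VN :: "('a^2^2) set" where "VS = {x \<in> sl2. discr x \<in> S}"
    and "VZ = {x \<in> sl2. discr x \<in> {0}} - {0}" and "VN = {x \<in> sl2. discr x \<in> N}"
  \<comment> \<open>Since q is odd, substituting q = 2k + 1 removes the truncated subtractions and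
    the halving from the class sizes.\<close>
  obtain k where k: "card S = k" "q = 2 * k + 1"
    using card_nonzero_squares[OF two] q zero_less_card_finite[where 'a = 'a]
    by (auto simp: S_def)
  have part: "S \<union> {0} \<union> N = UNIV" "S \<inter> {0} = {}" "(S \<union> {0}) \<inter> N = {}"
    by (auto simp: S_def N_def)
  have "q = card (S \<union> {0} \<union> N)"
    by (simp only: part q)
  also have "\<dots> = card S + card {0 :: 'a} + card N"
    by (simp only: card_Un_disjoint[OF finite finite] part(2,3))
  finally have cN: "card N = k"
    using k by simp
  have "{a::'a. a\<^sup>2 \<in> S} = - {0}" "{a::'a. a\<^sup>2 \<in> {0}} = {0}" "{a::'a. a\<^sup>2 \<in> N} = {}"
    by (auto simp: S_def N_def power2_eq_iff)
  moreover have "card (- {0::'a}) = q - 1"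
    by (simp add: Compl_eq_Diff_UNIV q)
  moreover have "{0} \<subseteq> {x \<in> sl2. discr x \<in> {0::'a}}"
    by (simp add: sl2.subspace_0 sl2.subspace_carrier discr_def)
  ultimately have "card VS = (q - 1) * q * k + q * (q - 1)" "card VZ = (q - 1) * q + q - 1"
    "card VN = (q - 1) * q * k"
    unfolding VS_def VZ_def VN_def using k cN
    by (simp_all only: card_discr_in q[symmetric] card_Diff_subset finite card.empty) simp_all
  then have card: "card VS = q * (q^2 - 1) div 2" "card VZ = q^2 - 1" "card VN = q * (q - 1)^2 div 2"
    unfolding k by (simp_all add: power2_eq_square algebra_simps)
  have deg: "out_degree (with_proj G) x = q * card (square_ratio_pairs (discr x)) - 2"
    if "x \<in> sl2" "x \<noteq> 0" for x
    using that by (simp add: G q out_degree_solvable_graph[OF two] card_solvable_nbhd[OF two])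
  have "out_degree (with_proj G) x = 2 * q^2 - q - 2" if x: "x \<in> VS" for x
  proof -
    obtain d where "discr x = d\<^sup>2" "d \<noteq> 0" "x \<in> sl2"
      using x unfolding VS_def S_def by blast
    moreover from this have "x \<noteq> 0"
      by (auto simp: discr_def)
    ultimately show ?thesis
      using deg[of x] card_square_ratio_pairs_square[OF two]
      by (simp add: q power2_eq_square diff_mult_distrib2)
  qed
  then have S: "image_mset (out_degree (with_proj G)) (mset_set VS) =
      replicate_mset (card VS) (2 * q^2 - q - 2)"
    by (subst image_mset_cong[where g = "\<lambda>_. 2 * q^2 - q - 2"]) (simp_all add: image_mset_const_eq)
  have "out_degree (with_proj G) x = q^2 - 2" if "x \<in> VZ" for x
    using that deg[of x] by (auto simp: VZ_def card_square_ratio_pairs_0 q power2_eq_square)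
  then have Z: "image_mset (out_degree (with_proj G)) (mset_set VZ) =
      replicate_mset (card VZ) (q^2 - 2)"
    by (subst image_mset_cong[where g = "\<lambda>_. q^2 - 2"]) (simp_all add: image_mset_const_eq)
  have "out_degree (with_proj G) x = q - 2" if "x \<in> VN" for x
  proof -
    have "x \<in> sl2" and ns: "\<And>d. discr x \<noteq> d\<^sup>2"
      using that unfolding VN_def N_def by blast+
    moreover have "x \<noteq> 0"
      using ns[of 0] by (auto simp: discr_def)
    ultimately show ?thesis
      using deg[of x] square_ratio_pairs_nonsquare[OF ns] by simp
  qed
  then have N: "image_mset (out_degree (with_proj G)) (mset_set VN) =
      replicate_mset (card VN) (q - 2)"
    by (subst image_mset_cong[where g = "\<lambda>_. q - 2"]) (simp_all add: image_mset_const_eq)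
  have 0: "discr (0::'a^2^2) = 0"
    by (simp add: discr_def)
  have "pverts G = VS \<union> VZ \<union> VN"
    using part 0
    unfolding G sl2.solvable_graph_def solvabilizer_sl2[OF two] VS_def VZ_def VN_def by auto
  moreover have "VS \<inter> VZ = {}" "(VS \<union> VZ) \<inter> VN = {}"
    using part
    unfolding VS_def VZ_def VN_def by auto
  ultimately show ?thesis
    unfolding degree_sequence_def
    by (simp add: mset_set_Union S Z N card)
qed

section \<open>Non-connectedness in odd characteristic\<close>

lemma not_connected_sl2:
  assumes two: "(2::'a::{field,finite}) \<noteq> 0"
  shows "\<not> Digraph_Component.connected
    (with_proj (sl2.solvable_graph :: ('a^2^2) pair_pre_digraph))"
proof
  let ?G = "sl2.solvable_graph :: ('a^2^2) pair_pre_digraph"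
  \<comment> \<open>\<open>Digraph_Component.connected\<close> is strong connectedness of this
    symmetric closure.\<close>
  let ?H = "with_proj (mk_symmetric (with_proj ?G))"
  assume conn: "Digraph_Component.connected (with_proj ?G)"
  \<comment> \<open>A nonsquare exists: otherwise squaring would be surjective, hence injective on a
    finite field, although 1 and -1 have the same square.\<close>
  have "\<exists>D::'a. \<forall>d. D \<noteq> d\<^sup>2"
  proof (rule ccontr)
    assume "\<not> ?thesis"
    then have "surj (\<lambda>d::'a. d\<^sup>2)"
      unfolding surj_def by blast
    then have "inj (\<lambda>d::'a. d\<^sup>2)"
      by (simp add: finite_UNIV_surj_inj)
    then have "(1::'a) = - 1"
      by (rule injD) simp
    with two show False
      by (metis add.right_inverse one_add_one)
  qed
  then obtain D :: 'a where D: "\<And>d. D \<noteq> d\<^sup>2" by blast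
  \<comment> \<open>A neighbour of \<open>u\<close> is a nonzero multiple t u, and its discriminant
    differs from that of \<open>u\<close> by the factor t^2.\<close>
  have nonsquare_step: "\<forall>d. discr v \<noteq> d\<^sup>2"
    if uv: "u \<rightarrow>\<^bsub>?H\<^esub> v" and u: "\<forall>d. discr u \<noteq> d\<^sup>2" for u v
  proof (intro allI notI)
    fix d assume d: "discr v = d\<^sup>2"
    have "u \<in> sl2" "v \<in> sl2" "v \<noteq> 0" "sl2.solvable (sl2.generated {u, v})"
      using uv by (auto simp: parcs_mk_symmetric sl2.solvable_graph_def solvabilizer_sl2[OF two]
          insert_commute)
    then obtain t where t: "v = mat_scale t u" "t \<noteq> 0"
      using solvable_nbhd_nonsquare[OF two, of u] u in_solvable_nbhd_iff[OF two, of u v]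
      by (force simp: mat2_eq_iff mat_scale_def)
    have "discr v = t\<^sup>2 * discr u"
      by (simp add: t discr_def mat_scale_def power2_eq_square algebra_simps)
    with d t have "discr u = (d / t)\<^sup>2"
      by (simp add: power_divide field_simps)
    with u show False by blast
  qed
  \<comment> \<open>Two vertices that no path joins: \<open>?x\<close> has the nonsquare
    discriminant \<open>D\<close>, whereas \<open>?y\<close> is nilpotent with discriminant 0 =
    0^2.\<close>
  let ?x = "sl2_mat 0 1 D" and ?y = "sl2_mat 0 1 0 :: 'a^2^2"
  have xy: "?x \<in> pverts ?G" "?y \<in> pverts ?G"
    by (simp_all add: sl2.solvable_graph_def solvabilizer_sl2[OF two])
  have inv: "\<forall>d. discr v \<noteq> d\<^sup>2" if "(?x, v) \<in> (arcs_ends ?H)\<^sup>*" for v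
    using that
  proof (induction rule: rtrancl_induct)
    case base
    show ?case using D by simp
  next
    case (step v w)
    then show ?case using nonsquare_step by blast
  qed
  have "?x \<rightarrow>\<^sup>*\<^bsub>?H\<^esub> ?y"
    using conn xy by (auto simp: Digraph_Component.connected_def strongly_connected_def)
  then have "\<forall>d. discr ?y \<noteq> d\<^sup>2"
    by (rule inv[OF reachable_rtranclI])
  then show False
    by (metis discr_sl2_mat add.right_neutral mult_zero_right)
qed

theorem theorem4p3:
  fixes q :: nat and G :: "('a::{field,finite}^2^2) pair_pre_digraph"
  assumes "q = CARD('a)" and "q > 2"
    and "G = sl2.solvable_graph"
  shows "(\<not> sl2.solvable (sl2 :: ('a^2^2) set) \<longrightarrow>
           degree_sequence G =
             replicate_mset (q * (q^2 - 1) div 2) (2 * q^2 - q - 2) +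
             replicate_mset (q^2 - 1) (q^2 - 2) +
             replicate_mset (q * (q - 1)^2 div 2) (q - 2)) \<and>
         \<not> Digraph_Component.connected (with_proj G)"
proof (cases "(2::'a) = 0")
  case True
  then have solv: "sl2.solvable (sl2 :: ('a^2^2) set)"
    by (simp add: solvable_sl2_iff)
  have "sl2.solvable (sl2.generated {h, x})" if "h \<in> sl2" "x \<in> sl2" for h x :: "'a^2^2"
  proof (rule sl2.solvable_subset[OF solv])
    show "sl2.generated {h, x} \<subseteq> sl2"
      using that by (intro sl2.generated_minimal sl2.lie_subalgebra_carrier) auto
    show "0 \<in> sl2.generated {h, x}"
      using that sl2.lie_subalgebra_generated[of "{h, x}"]
      by (auto simp: sl2.lie_subalgebra_def sl2.subspace_0)
  qed
  then have "pverts G = {}"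
    by (auto simp: assms(3) sl2.solvable_graph_def sl2.solvabilizer_def)
  \<comment> \<open>In characteristic 2 the degree claim holds vacuously, and
    \<open>strongly_connected\<close> demands a nonempty vertex set, so the empty graph is not
    connected.\<close>
  with solv show ?thesis
    by (simp add: Digraph_Component.connected_def strongly_connected_def)
next
  case False
  then show ?thesis
    using degree_sequence_sl2[OF False assms(1,3)] not_connected_sl2[OF False] assms(3) by simp
qed

end
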